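(* Assume $\mathcal{D}\cap\mathcal{T}=\emptyset$, $\mathcal{D}\cap\mathcal{B}=\emptyset$ and $\mathcal{T}\cap\mathcal{C}=\emptyset$. The following two conditions are equivalent, and if either of them holds then the DDPDF is solvable for the system $\dot x=Ax+Bu+Dw$, $y=Cx$, $z=Tx$: (a) $\mathcal{S}^\circ(\mathcal{C})\subseteq\mathcal{Z}^\circ(\mathcal{B})$; (b) letting $\mathcal{P}_1,\dots,\mathcal{P}_\ell$ be all possible $\mathcal{D}$-to-$\mathcal{T}$ paths, for every path $\mathcal{P}_j=\{v_1,\dots,v_{\kappa_j}\}$ (nodes relabeled along the path) of length $\kappa_j-1\geq1$, with $v_1\in\mathcal{D}$ and $v_{\kappa_j}\in\mathcal{T}$, the indexes $$o_j=\min\{s\in\{1,\dots,\kappa_j-1\}:v_s\in\mathcal{C}\cap\mathcal{P}_j\},\qquad i_j=\max\{s\in\{2,\dots,\kappa_j\}:v_s\in\mathcal{B}\cap\mathcal{P}_j\}$$ exist and satisfy $o_j<i_j$, for all $j\in\{1,\dots,\ell\}$.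
   Context: Let $(\mathcal{V},\mathcal{E},A)$ be a digraph with node set $\mathcal{V}=\{v_1,\dots,v_n\}$, edge set $\mathcal{E}$, where $(v_i,v_j)\in\mathcal{E}$ means $v_i\to v_j$, and weighted adjacency matrix $A\in\mathbb{R}^{n\times n}$ with $A_{ji}\neq0$ if and only if $(v_i,v_j)\in\mathcal{E}$. Let $\mathcal{B},\mathcal{C},\mathcal{D},\mathcal{T}\subseteq\mathcal{V}$ be the sets of input, output, disturbance and target nodes. The columns of $B$ (resp. $D$) are the canonical vectors $e_i$ with $v_i\in\mathcal{B}$ (resp. $v_i\in\mathcal{D}$); the rows of $C$ (resp. $T$) are the $e_i^\top$ with $v_i\in\mathcal{C}$ (resp. $v_i\in\mathcal{T}$). $\mathcal{Z}^\circ(\mathcal{B})$ is the (stationary) limit of $\mathcal{Z}_0=\mathcal{V}\setminus\mathcal{T}$, $\mathcal{Z}_{k+1}=\mathcal{Z}_k\setminus\{v_i\in\mathcal{Z}_k:\exists\,(v_i,v_j)\in\mathcal{E}\text{ with }v_j\notin\mathcal{Z}_k\cup\mathcal{B}\}$; it is the maximal subset $\mathcal{Z}$ of $\mathcal{V}\setminus\mathcal{T}$ such that every edge starting in $\mathcal{Z}$ ends in $\mathcal{Z}\cup\mathcal{B}$. $\mathcal{S}^\circ(\mathcal{C})$ is the (stationary) limit of $\mathcal{S}_0=\mathcal{D}$, $\mathcal{S}_{k+1}=\mathcal{S}_k\cup\{v_j\notin\mathcal{S}_k:\exists\,(v_i,v_j)\in\mathcal{E}\text{ with }v_i\in\mathcal{S}_k\setminus\mathcal{C}\}$;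 it is the minimal superset $\mathcal{S}$ of $\mathcal{D}$ such that every edge starting in $\mathcal{S}\setminus\mathcal{C}$ ends in $\mathcal{S}$. The DDPDF (disturbance decoupling problem by dynamical feedback) is solvable if there exist a compensator dimension $k\le n$ and real matrices $K,L,M,G$ such that, with $\dot{\hat x}=K\hat x+Ly$, $u=-M\hat x-Gy$, $\hat x\in\mathbb{R}^k$, the closed loop matrices $$A_c=\begin{bmatrix} A-BGC & -BM \\ L C & K \end{bmatrix},\quad D_c=\begin{bmatrix} D \\ 0 \end{bmatrix},\quad T_c=\begin{bmatrix} T & 0 \end{bmatrix}$$ satisfy $T_c(sI-A_c)^{-1}D_c=0$ for all $s$ (as a rational matrix identity); equivalently, there is an $A_c$-invariant subspace $\mathcal{W}_c$ with $\mathrm{Im}\,D_c\subseteq\mathcal{W}_c\subseteq\ker T_c$. A $\mathcal{D}$-to-$\mathcal{T}$ path is a sequence of distinct nodes, the first in $\mathcal{D}$ and the last in $\mathcal{T}$, in which each consecutive pair is an edge; its length is its number of edges. *)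

theory Defs
  imports
    "Graph_Theory.Pair_Digraph"
    "Graph_Theory.Vertex_Walk"
    "Jordan_Normal_Form.Char_Poly"
    "Jordan_Normal_Form.Gauss_Jordan_Elimination"
    "HOL-Computational_Algebra.Polynomial_Factorial"
begin

section \<open>Weighted digraphs\<close>

text \<open>
  The nodes \<open>v\<^sub>1, \<dots>, v\<^sub>n\<close> are represented by the matrix indices \<open>0, \<dots>, n - 1\<close>.
  Note the transposition: the edge from \<open>i\<close> to \<open>j\<close> carries the weight in row \<open>j\<close>, column \<open>i\<close>.
  Self-loops are permitted.
\<close>

definition weighted_digraph :: "nat \<Rightarrow> nat pair_pre_digraph \<Rightarrow> real mat \<Rightarrow> bool" where
  "weighted_digraph n G A \<longleftrightarrow>
     pair_fin_digraph G \<and> pverts G = {0..<n} \<and> A \<in> carrier_mat n n \<and>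
     (\<forall>i<n. \<forall>j<n. A $$ (j, i) \<noteq> 0 \<longleftrightarrow> (i, j) \<in> parcs G)"

text \<open>
  The canonical vectors indexed by a finite set of nodes, in increasing order of the index,
  as columns (input and disturbance matrices) or as rows (output and target matrices).
\<close>

definition node_cols :: "nat \<Rightarrow> nat set \<Rightarrow> real mat" where
  "node_cols n X = mat_of_cols n (map (unit_vec n) (sorted_list_of_set X))"

definition node_rows :: "nat \<Rightarrow> nat set \<Rightarrow> real mat" where
  "node_rows n X = mat_of_rows n (map (unit_vec n) (sorted_list_of_set X))"


section \<open>The node sets \<open>Z\<degree>\<close> and \<open>S\<degree>\<close>\<close>

primrec Z_seq :: "'v pair_pre_digraph \<Rightarrow> 'v set \<Rightarrow> 'v set \<Rightarrow> nat \<Rightarrow> 'v set" where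
  "Z_seq G \<T> \<B> 0 = pverts G - \<T>"
| "Z_seq G \<T> \<B> (Suc k) = Z_seq G \<T> \<B> k -
     {v \<in> Z_seq G \<T> \<B> k. \<exists>w. (v, w) \<in> parcs G \<and> w \<notin> Z_seq G \<T> \<B> k \<union> \<B>}"

primrec S_seq :: "'v pair_pre_digraph \<Rightarrow> 'v set \<Rightarrow> 'v set \<Rightarrow> nat \<Rightarrow> 'v set" where
  "S_seq G \<D> \<C> 0 = \<D>"
| "S_seq G \<D> \<C> (Suc k) = S_seq G \<D> \<C> k \<union>
     {w. w \<notin> S_seq G \<D> \<C> k \<and> (\<exists>v. (v, w) \<in> parcs G \<and> v \<in> S_seq G \<D> \<C> k - \<C>)}"

text \<open>
  The sequences are monotone, so their limits are the intersection and the union; the lemmas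
  \<open>Z_seq_stationary\<close> and \<open>S_seq_stationary\<close> below show that on finite digraphs the limits
  are attained.
\<close>

definition Z_lim :: "'v pair_pre_digraph \<Rightarrow> 'v set \<Rightarrow> 'v set \<Rightarrow> 'v set" where
  "Z_lim G \<T> \<B> = (\<Inter>k. Z_seq G \<T> \<B> k)"

definition S_lim :: "'v pair_pre_digraph \<Rightarrow> 'v set \<Rightarrow> 'v set \<Rightarrow> 'v set" where
  "S_lim G \<D> \<C> = (\<Union>k. S_seq G \<D> \<C> k)"

lemma decseq_Z_seq: "decseq (Z_seq G \<T> \<B>)"
  by (rule decseq_SucI) auto

lemma incseq_S_seq: "incseq (S_seq G \<D> \<C>)"
  by (rule incseq_SucI) auto

lemma incseq_finite_stationary:
  fixes X :: "nat \<Rightarrow> 'v set"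
  assumes inc: "incseq X" and fin: "finite U" and sub: "\<And>k. X k \<subseteq> U"
  shows "\<exists>N. \<forall>k\<ge>N. X k = (\<Union>j. X j)"
proof -
  let ?Y = "\<Union>j. X j"
  have finY: "finite ?Y"
    using fin sub by (meson UN_least finite_subset)
  have "\<forall>x\<in>?Y. \<exists>j. x \<in> X j" by blast
  then obtain f where f: "\<forall>x\<in>?Y. x \<in> X (f x)" by metis
  have "X k = ?Y" if k: "k \<ge> Max (insert 0 (f ` ?Y))" for k
  proof
    show "?Y \<subseteq> X k"
    proof
      fix x assume x: "x \<in> ?Y"
      then have "f x \<le> Max (insert 0 (f ` ?Y))" using finY by (intro Max_ge) auto
      then have "X (f x) \<subseteq> X k" using k inc by (meson incseqD order_trans)
      then show "x \<in> X k" using f x by blast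
    qed
  qed blast
  then show ?thesis by blast
qed

lemma Z_seq_stationary:
  assumes "pair_fin_digraph G"
  shows "\<exists>N. \<forall>k\<ge>N. Z_seq G \<T> \<B> k = Z_lim G \<T> \<B>"
proof -
  have fin: "finite (pverts G)"
    using assms by (rule pair_fin_digraph.pair_finite_verts)
  have sub: "Z_seq G \<T> \<B> k \<subseteq> pverts G" for k
    by (induction k) auto
  have inc: "incseq (\<lambda>k. pverts G - Z_seq G \<T> \<B> k)"
    using decseq_Z_seq[of G \<T> \<B>] by (auto simp: incseq_def decseq_def)
  obtain N where "\<forall>k\<ge>N. pverts G - Z_seq G \<T> \<B> k = (\<Union>j. pverts G - Z_seq G \<T> \<B> j)"
    using incseq_finite_stationary[OF inc fin] by auto
  moreover have "(\<Union>j. pverts G - Z_seq G \<T> \<B> j) = pverts G - Z_lim G \<T> \<B>"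
    by (auto simp: Z_lim_def)
  moreover have "Z_lim G \<T> \<B> \<subseteq> pverts G"
    using sub by (auto simp: Z_lim_def)
  ultimately show ?thesis
    using sub by (metis double_diff subset_refl)
qed

lemma S_seq_stationary:
  assumes "pair_fin_digraph G" "\<D> \<subseteq> pverts G"
  shows "\<exists>N. \<forall>k\<ge>N. S_seq G \<D> \<C> k = S_lim G \<D> \<C>"
proof -
  have wf: "pair_wf_digraph G"
    using assms(1) by (simp add: pair_fin_digraph_def)
  have sub: "S_seq G \<D> \<C> k \<subseteq> pverts G" for k
    using assms(2) pair_wf_digraph.in_arcsD2[OF wf] by (induction k) auto
  show ?thesis
    using incseq_finite_stationary[OF incseq_S_seq
        pair_fin_digraph.pair_finite_verts[OF assms(1)] sub]
    by (simp add: S_lim_def)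
qed


section \<open>Paths\<close>

definition path_from_to :: "'v pair_pre_digraph \<Rightarrow> 'v set \<Rightarrow> 'v set \<Rightarrow> 'v list \<Rightarrow> bool" where
  "path_from_to G \<D> \<T> p \<longleftrightarrow> vpath p (with_proj G) \<and> hd p \<in> \<D> \<and> last p \<in> \<T>"

text \<open>Positions along a path are counted from 1, whereas list indexing starts at 0.\<close>

definition output_positions :: "'v set \<Rightarrow> 'v list \<Rightarrow> nat set" where
  "output_positions \<C> p = {s \<in> {1..length p - 1}. p ! (s - 1) \<in> \<C>}"

definition input_positions :: "'v set \<Rightarrow> 'v list \<Rightarrow> nat set" where
  "input_positions \<B> p = {s \<in> {2..length p}. p ! (s - 1) \<in> \<B>}"

definition output_before_input_on_paths ::
  "'v pair_pre_digraph \<Rightarrow> 'v set \<Rightarrow> 'v set \<Rightarrow> 'v set \<Rightarrow> 'v set \<Rightarrow> bool" where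
  "output_before_input_on_paths G \<B> \<C> \<D> \<T> \<longleftrightarrow>
     (\<forall>p. path_from_to G \<D> \<T> p \<and> vwalk_length p \<ge> 1 \<longrightarrow>
        output_positions \<C> p \<noteq> {} \<and> input_positions \<B> p \<noteq> {} \<and>
        Min (output_positions \<C> p) < Max (input_positions \<B> p))"


section \<open>Disturbance decoupling by dynamical feedback\<close>

text \<open>
  Transfer matrices have entries in the field of rational functions in one indeterminate,
  \<open>real poly fract\<close>. The matrix \<open>char_poly_matrix A\<close> is \<open>sI - A\<close>, with the
  indeterminate \<open>[:0, 1:]\<close> in the role of \<open>s\<close>; it is always invertible over this field, see
  \<open>resolvent_inverse\<close> below.
\<close>

definition const_mat :: "real mat \<Rightarrow> real poly fract mat" where
  "const_mat = map_mat (\<lambda>a. to_fract [:a:])"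

definition resolvent :: "real mat \<Rightarrow> real poly fract mat" where
  "resolvent A = the (mat_inverse (map_mat to_fract (char_poly_matrix A)))"

definition transfer_matrix :: "real mat \<Rightarrow> real mat \<Rightarrow> real mat \<Rightarrow> real poly fract mat" where
  "transfer_matrix T A D = const_mat T * resolvent A * const_mat D"

lemma resolvent_inverse:
  assumes A: "A \<in> carrier_mat n n"
  shows "resolvent A \<in> carrier_mat n n"
    and "map_mat to_fract (char_poly_matrix A) * resolvent A = 1\<^sub>m n"
    and "resolvent A * map_mat to_fract (char_poly_matrix A) = 1\<^sub>m n"
proof -
  interpret h: comm_ring_hom "to_fract :: real poly \<Rightarrow> real poly fract"
    by unfold_locales auto
  let ?P = "map_mat to_fract (char_poly_matrix A)"
  have P: "?P \<in> carrier_mat n n" using A by simp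
  have "char_poly A \<noteq> 0" using degree_monic_char_poly[OF A] by auto
  then have "det ?P \<noteq> 0" by (simp add: char_poly_def)
  then have "?P \<in> Units (ring_mat TYPE(real poly fract) n ())"
    by (rule det_non_zero_imp_unit[OF P])
  then obtain R where "mat_inverse ?P = Some R"
    using mat_inverse(1)[OF P, where b = "()"] by (cases "mat_inverse ?P") auto
  then have "resolvent A = R" "?P * R = 1\<^sub>m n \<and> R * ?P = 1\<^sub>m n \<and> R \<in> carrier_mat n n"
    using mat_inverse(2)[OF P] by (simp_all add: resolvent_def)
  then show "resolvent A \<in> carrier_mat n n" "?P * resolvent A = 1\<^sub>m n"
    "resolvent A * ?P = 1\<^sub>m n" by auto
qed

definition DDPDF_solvable :: "real mat \<Rightarrow> real mat \<Rightarrow> real mat \<Rightarrow> real mat \<Rightarrow> real mat \<Rightarrow> bool" where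
  "DDPDF_solvable A B C D T \<longleftrightarrow>
     (\<exists>k \<le> dim_row A. \<exists>K L M G.
        K \<in> carrier_mat k k \<and> L \<in> carrier_mat k (dim_row C) \<and>
        M \<in> carrier_mat (dim_col B) k \<and> G \<in> carrier_mat (dim_col B) (dim_row C) \<and>
        (let Ac = four_block_mat (A - B * G * C) (- (B * M)) (L * C) K;
             Dc = D @\<^sub>r 0\<^sub>m k (dim_col D);
             Tc = four_block_mat T (0\<^sub>m (dim_row T) k) (0\<^sub>m 0 (dim_col T)) (0\<^sub>m 0 k)
         in transfer_matrix Tc Ac Dc = 0\<^sub>m (dim_row T) (dim_col D)))"

end

theory Submission
  imports Defs
begin

text \<open>
  \<^emph>\<open>The equivalence.\<close> Unfolding the two recursions, a node is in \<open>S\<degree>\<close> iff some walk from \<open>\<D>\<close>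
  reaches it with no output node before it, and it is outside \<open>Z\<degree>\<close> iff some walk leads from it
  to \<open>\<T>\<close> with no input node after it. A node of \<open>S\<degree> - Z\<degree>\<close> is therefore the same as a walk
  from \<open>\<D>\<close> to \<open>\<T>\<close> together with a node on it that has no output before it and no input after
  it; call such a walk unguarded. Cutting out cycles keeps a walk unguarded, so the walk may be
  taken to be a path, and for a path being unguarded is precisely the failure of ``the first
  output comes before the last input'': the two readings of (a) and (b) are the same
  (\<open>S_lim_subset_Z_lim_iff\<close>).

  \<^emph>\<open>The compensator.\<close> Write \<open>A\<^bsub>XY\<^esub>\<close> for \<open>A\<close> with all entries outside rows \<open>X\<close> and columns \<open>Y\<close>
  set to zero, \<open>B'\<close>, \<open>C'\<close> for the complements of \<open>\<B>\<close>, \<open>\<C>\<close>, and \<open>V\<close> for the set of all nodes.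
  The columns of \<open>B\<close> and the rows of \<open>C\<close> being unit vectors, there are gains with
  \<open>BGC = A\<^bsub>BC\<^esub>\<close>, \<open>BM = A\<^bsub>BC'\<^esub>\<close>, \<open>LC = A\<^bsub>B'C\<^esub>\<close>; take a compensator of dimension \<open>n\<close> with
  \<open>K = A\<^bsub>B'C'\<^esub>\<close>. It is an observer: with \<open>e = x - x'\<close> for the plant state \<open>x\<close> and the
  compensator state \<open>x'\<close>, the closed loop is the cascade
    \<open>s e = A\<^bsub>VC'\<^esub> e + D w\<close>,  \<open>s x' = A\<^bsub>B'V\<^esub> x' + A\<^bsub>B'C\<^esub> e\<close>.
  Edges out of \<open>S\<degree> - \<C>\<close> stay in \<open>S\<degree>\<close>, so \<open>e\<close> stays supported on \<open>S\<degree>\<close>; edges out of \<open>Z\<degree>\<close>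
  stay in \<open>Z\<degree> \<union> \<B>\<close> and \<open>S\<degree> \<subseteq> Z\<degree>\<close>, so \<open>x'\<close> stays supported on \<open>Z\<degree>\<close>. Hence \<open>x = e + x'\<close> is
  supported on \<open>Z\<degree>\<close>, which avoids \<open>\<T>\<close>, and the target is never reached
  (\<open>DDPDF_solvable_if_nested_invariants\<close>).
\<close>


section \<open>Walks with no output before and no input after some node\<close>

text \<open>
  Along \<open>p\<close> a disturbance could reach the node \<open>v\<close> before any measurement sees it, and travel from
  \<open>v\<close> to the end of \<open>p\<close> without meeting an input. The node \<open>v\<close> itself may be an input or an
  output.
\<close>

definition unguarded :: "'v set \<Rightarrow> 'v set \<Rightarrow> 'v list \<Rightarrow> bool" where
  "unguarded \<B> \<C> p \<longleftrightarrow> (\<exists>us v ws. p = us @ v # ws \<and> set us \<inter> \<C> = {} \<and> set ws \<inter> \<B> = {})"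

text \<open>The positional form, in which the first output and the last input of \<open>p\<close> can be compared.\<close>

lemma unguarded_conv_nth:
  "unguarded \<B> \<C> p \<longleftrightarrow>
     (\<exists>s<length p. (\<forall>i<s. p ! i \<notin> \<C>) \<and> (\<forall>i. s < i \<longrightarrow> i < length p \<longrightarrow> p ! i \<notin> \<B>))"
proof
  assume "unguarded \<B> \<C> p"
  then obtain us v ws where p: "p = us @ v # ws" "set us \<inter> \<C> = {}" "set ws \<inter> \<B> = {}"
    by (auto simp: unguarded_def)
  have "p ! i \<notin> \<B>" if "length us < i" "i < length p" for i
  proof -
    have "p ! i = ws ! (i - Suc (length us))" "i - Suc (length us) < length ws"
      using that
      by (auto simp: p(1) nth_append nth_Cons split: nat.split)
        (metis diff_Suc_1 diff_Suc_Suc diff_commute Suc_eq_plus1 diff_diff_left)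
    then show ?thesis using p(3) by (metis disjoint_iff nth_mem)
  qed
  moreover have "p ! i \<notin> \<C>" if "i < length us" for i
    using that p(2) by (auto simp: p(1) nth_append dest: nth_mem)
  ultimately show "\<exists>s<length p. (\<forall>i<s. p ! i \<notin> \<C>) \<and> (\<forall>i. s < i \<longrightarrow> i < length p \<longrightarrow> p ! i \<notin> \<B>)"
    by (intro exI[of _ "length us"]) (auto simp: p(1))
next
  assume "\<exists>s<length p. (\<forall>i<s. p ! i \<notin> \<C>) \<and> (\<forall>i. s < i \<longrightarrow> i < length p \<longrightarrow> p ! i \<notin> \<B>)"
  then obtain s where s: "s < length p" "\<And>i. i < s \<Longrightarrow> p ! i \<notin> \<C>"
    "\<And>i. s < i \<Longrightarrow> i < length p \<Longrightarrow> p ! i \<notin> \<B>" by blast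
  have "p = take s p @ p ! s # drop (Suc s) p" using s(1) by (rule id_take_nth_drop)
  moreover have "set (take s p) \<inter> \<C> = {}" using s by (auto simp: in_set_conv_nth)
  moreover have "set (drop (Suc s) p) \<inter> \<B> = {}" using s by (auto simp: in_set_conv_nth)
  ultimately show "unguarded \<B> \<C> p" unfolding unguarded_def by blast
qed

text \<open>
  If the walk is unguarded at position \<open>s\<close>, then every output is at or after \<open>s\<close> and every input at
  or before \<open>s\<close>, so the first output cannot strictly precede the last input. Conversely the first
  output is such a position when the order is wrong; if there is no output the last node serves,
  and if there is no input the first one does.
\<close>

lemma output_before_input_iff_not_unguarded:
  assumes len: "length p \<ge> 2"
  shows "output_positions \<C> p \<noteq> {} \<and> input_positions \<B> p \<noteq> {} \<and>
    Min (output_positions \<C> p) < Max (input_positions \<B> p) \<longleftrightarrow> \<not> unguarded \<B> \<C> p"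
    (is "?ordered \<longleftrightarrow> _")
proof -
  let ?O = "output_positions \<C> p" and ?I = "input_positions \<B> p"
  have fin: "finite ?O" "finite ?I" by (auto simp: output_positions_def input_positions_def)
  have O: "Suc i \<in> ?O" if "p ! i \<in> \<C>" "Suc i < length p" for i
    using that by (auto simp: output_positions_def)
  have I: "Suc i \<in> ?I" if "p ! i \<in> \<B>" "0 < i" "i < length p" for i
    using that by (auto simp: input_positions_def)
  have "\<not> ?ordered" if "unguarded \<B> \<C> p"
  proof
    assume ord: ?ordered
    obtain s where "(\<forall>i<s. p ! i \<notin> \<C>) \<and> (\<forall>i. s < i \<longrightarrow> i < length p \<longrightarrow> p ! i \<notin> \<B>)"
      using \<open>unguarded \<B> \<C> p\<close> unfolding unguarded_conv_nth by blast
    then have s: "\<And>i. p ! i \<in> \<C> \<Longrightarrow> s \<le> i" "\<And>i. p ! i \<in> \<B> \<Longrightarrow> i < length p \<Longrightarrow> i \<le> s"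
      by (meson not_le)+
    have "Min ?O \<in> ?O" "Max ?I \<in> ?I" using ord fin by auto
    then have "p ! (Min ?O - 1) \<in> \<C>" "Min ?O \<ge> 1"
      "p ! (Max ?I - 1) \<in> \<B>" "Max ?I \<ge> 2" "Max ?I \<le> length p"
      by (simp_all add: output_positions_def input_positions_def)
    then have "s \<le> Min ?O - 1" "Max ?I - 1 \<le> s" "Min ?O \<ge> 1"
      using s(1)[of "Min ?O - 1"] s(2)[of "Max ?I - 1"] by simp_all
    then show False using ord by linarith
  qed
  moreover have "unguarded \<B> \<C> p" if nord: "\<not> ?ordered"
  proof -
    consider "?O = {}" | "?I = {}" | "?O \<noteq> {}" "?I \<noteq> {}" "Max ?I \<le> Min ?O"
      using nord by force
    then show ?thesis
    proof cases
      case 1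
      then show ?thesis using len O unfolding unguarded_conv_nth
        by (intro exI[of _ "length p - 1"]) fastforce
    next
      case 2
      then show ?thesis using len I unfolding unguarded_conv_nth
        by (intro exI[of _ 0]) fastforce
    next
      case 3
      have min: "Min ?O \<in> ?O" using 3 fin by auto
      then have bd: "1 \<le> Min ?O" "Min ?O < length p" using len by (auto simp: output_positions_def)
      have "p ! i \<notin> \<C>" if "i < Min ?O - 1" for i
        using O[of i] that bd Min_le[OF fin(1), of "Suc i"] by auto
      moreover have "p ! i \<notin> \<B>" if "Min ?O - 1 < i" "i < length p" for i
        using I[of i] that bd 3 Max_ge[OF fin(2), of "Suc i"] by auto
      ultimately show ?thesis using bd unfolding unguarded_conv_nth
        by (intro exI[of _ "Min ?O - 1"]) auto
    qed
  qed
  ultimately show ?thesis by blast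
qed

text \<open>The three relative positions of two marked elements in one list.\<close>

lemma append_eq_split:
  assumes "us @ v # ws = xs @ y # zs"
  shows "(\<exists>k. xs = us @ v # k \<and> ws = k @ y # zs) \<or> us = xs \<and> v = y \<and> ws = zs \<or>
    (\<exists>k. us = xs @ y # k \<and> k @ v # ws = zs)"
proof -
  obtain k where "us = xs @ k \<and> k @ v # ws = y # zs \<or> us @ k = xs \<and> v # ws = k @ y # zs"
    using assms unfolding append_eq_append_conv2 by blast
  then show ?thesis by (cases k) auto
qed

text \<open>
  If the distinguished node \<open>v\<close> lies outside the cycle it survives. If it lies on the cycle, \<open>y\<close>
  takes over: what precedes the first visit to \<open>y\<close> precedes \<open>v\<close>, and what follows the second
  visit follows \<open>v\<close>.
\<close>

lemma unguarded_cut_cycle: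
  assumes "unguarded \<B> \<C> (xs @ y # ys @ y # zs)"
  shows "unguarded \<B> \<C> (xs @ y # zs)"
proof -
  obtain us v ws where eq: "us @ v # ws = xs @ y # ys @ y # zs"
    and d: "set us \<inter> \<C> = {}" "set ws \<inter> \<B> = {}"
    using assms unfolding unguarded_def by metis
  consider
      xs' where "xs = us @ v # xs'" "ws = xs' @ y # ys @ y # zs"
    | "us = xs" "v = y" "ws = ys @ y # zs"
    | us' where "us = xs @ y # us'" "us' @ v # ws = ys @ y # zs"
    using append_eq_split[OF eq] by metis
  then show ?thesis
  proof cases
    case 1
    then show ?thesis using d unfolding unguarded_def
      by (intro exI[of _ us] exI[of _ v] exI[of _ "xs' @ y # zs"]) auto
  next
    case 2
    then show ?thesis using d unfolding unguarded_def by (intro exI[of _ xs]) auto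
  next
    case (3 us')
    consider "set zs \<subseteq> set ws" | us'' where "us' = ys @ y # us''" "us'' @ v # ws = zs"
    proof -
      from append_eq_split[OF 3(2)] show thesis
      proof (elim disjE exE conjE)
        fix k assume "ys = us' @ v # k" "ws = k @ y # zs"
        then show thesis by (intro that(1)) auto
      qed (auto intro: that)
    qed
    then show ?thesis
    proof cases
      case 1
      then show ?thesis using d 3(1) unfolding unguarded_def by (intro exI[of _ xs]) auto
    next
      case (2 us'')
      then show ?thesis using d 3(1) unfolding unguarded_def
        by (intro exI[of _ "xs @ y # us''"] exI[of _ v] exI[of _ ws]) auto
    qed
  qed
qed

lemma vwalk_append_iff:
  "vwalk (xs @ y # zs) G \<longleftrightarrow> vwalk (xs @ [y]) G \<and> vwalk (y # zs) G"
proof (cases "xs = []")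
  case True
  then show ?thesis by (auto simp: vwalk_def)
next
  case False
  then show ?thesis
    using vwalk_arcs_append[of xs "y # zs"] vwalk_arcs_append[of xs "[y]"] by (auto simp: vwalk_def)
qed

text \<open>
  A shortest path with the same ends could run through entirely different nodes. Removing one
  cycle at a time instead only drops nodes, and the distinguished node can be followed.
\<close>

lemma unguarded_vwalk_imp_vpath:
  assumes "vwalk p G" "unguarded \<B> \<C> p"
  shows "\<exists>q. vpath q G \<and> unguarded \<B> \<C> q \<and> hd q = hd p \<and> last q = last p"
  using assms
proof (induction p rule: length_induct)
  case (1 p)
  show ?case
  proof (cases "distinct p")
    case True
    then show ?thesis using 1 by blast
  next
    case False
    then obtain xs y ys zs where p: "p = xs @ y # ys @ y # zs"
      using not_distinct_decomp by fastforce
    have "vwalk (xs @ y # zs) G"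
      using 1(2) unfolding p using vwalk_append_iff[of xs y] vwalk_append_iff[of "y # ys" y zs]
      by (metis append_Cons)
    moreover have "unguarded \<B> \<C> (xs @ y # zs)" using 1(3) unfolding p by (rule unguarded_cut_cycle)
    moreover have "length (xs @ y # zs) < length p" "hd (xs @ y # zs) = hd p"
      "last (xs @ y # zs) = last p" by (auto simp: p hd_append)
    ultimately show ?thesis using 1(1) by metis
  qed
qed

section \<open>The limit sets in terms of walks\<close>

lemma S_lim_iff_vwalk:
  assumes "pair_wf_digraph G" "\<D> \<subseteq> pverts G"
  shows "v \<in> S_lim G \<D> \<C> \<longleftrightarrow>
    (\<exists>us. vwalk (us @ [v]) (with_proj G) \<and> hd (us @ [v]) \<in> \<D> \<and> set us \<inter> \<C> = {})"
    (is "_ \<longleftrightarrow> ?walk v")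
proof
  interpret pair_wf_digraph G by fact
  have "?walk v" if "v \<in> S_seq G \<D> \<C> k" for k
    using that
  proof (induction k arbitrary: v)
    case 0
    then show ?case using assms(2) by (intro exI[of _ "[]"]) (auto simp: vwalk_def)
  next
    case (Suc k)
    show ?case
    proof (cases "v \<in> S_seq G \<D> \<C> k")
      case True
      then show ?thesis by (rule Suc.IH)
    next
      case False
      then obtain u where u: "(u, v) \<in> parcs G" "u \<in> S_seq G \<D> \<C> k" "u \<notin> \<C>" using Suc.prems by auto
      obtain us where us: "vwalk (us @ [u]) (with_proj G)" "hd (us @ [u]) \<in> \<D>" "set us \<inter> \<C> = {}"
        using Suc.IH[OF u(2)] by blast
      have "vwalk [u, v] (with_proj G)" using u(1) in_arcsD1 in_arcsD2 by (auto simp: vwalk_def)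
      then have "vwalk ((us @ [u]) @ [v]) (with_proj G)"
        using us(1) by (simp add: vwalk_append_iff[of us u "[v]"])
      then show ?thesis using us u by (intro exI[of _ "us @ [u]"]) (auto simp: hd_append)
    qed
  qed
  then show "?walk v" if "v \<in> S_lim G \<D> \<C>" using that by (auto simp: S_lim_def)
next
  have "v \<in> S_lim G \<D> \<C>" if "vwalk (us @ [v]) (with_proj G)" "hd (us @ [v]) \<in> \<D>" "set us \<inter> \<C> = {}" for us
    using that
  proof (induction us arbitrary: v rule: rev_induct)
    case Nil
    then show ?case by (auto simp: S_lim_def intro: exI[of _ 0])
  next
    case (snoc u us)
    have "vwalk (us @ [u]) (with_proj G)" "vwalk [u, v] (with_proj G)"
      using snoc.prems(1) by (simp_all add: vwalk_append_iff[of us u "[v]"])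
    then have "u \<in> S_lim G \<D> \<C>" "(u, v) \<in> parcs G"
      using snoc.IH[of u] snoc.prems(2,3) by (auto simp: hd_append vwalk_def split: if_splits)
    moreover have "u \<notin> \<C>" using snoc.prems(3) by simp
    ultimately obtain k where "v \<in> S_seq G \<D> \<C> (Suc k)" by (auto simp: S_lim_def)
    then show ?case unfolding S_lim_def by blast
  qed
  then show "v \<in> S_lim G \<D> \<C>" if "?walk v" using that by blast
qed

text \<open>The next two facts make the limits invariant in the sense needed for the compensator.\<close>

lemma S_lim_step:
  assumes "(u, v) \<in> parcs G" "u \<in> S_lim G \<D> \<C>" "u \<notin> \<C>"
  shows "v \<in> S_lim G \<D> \<C>"
proof -
  obtain k where "v \<in> S_seq G \<D> \<C> (Suc k)" using assms by (auto simp: S_lim_def)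
  then show ?thesis unfolding S_lim_def by blast
qed

lemma Z_lim_step:
  assumes "pair_fin_digraph G" "(u, v) \<in> parcs G" "u \<in> Z_lim G \<T> \<B>"
  shows "v \<in> Z_lim G \<T> \<B> \<union> \<B>"
proof -
  obtain N where N: "Z_seq G \<T> \<B> k = Z_lim G \<T> \<B>" if "k \<ge> N" for k
    using Z_seq_stationary[OF assms(1)] by metis
  \<comment> \<open>membership in the stage after \<open>N\<close> constrains the edge with respect to stage \<open>N\<close>, the limit\<close>
  have "u \<in> Z_seq G \<T> \<B> (Suc N)" using assms(3) by (simp only: N[of "Suc N"] le_SucI order_refl)
  then have "v \<in> Z_seq G \<T> \<B> N \<union> \<B>" using assms(2) by auto
  then show ?thesis using N[of N] by simp
qed

lemma Z_lim_subset: "Z_lim G \<T> \<B> \<subseteq> pverts G - \<T>"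
  unfolding Z_lim_def by (metis INF_lower UNIV_I Z_seq.simps(1))

lemma not_in_Z_lim_iff_vwalk:
  assumes G: "pair_fin_digraph G" and v: "v \<in> pverts G"
  shows "v \<notin> Z_lim G \<T> \<B> \<longleftrightarrow>
    (\<exists>ws. vwalk (v # ws) (with_proj G) \<and> last (v # ws) \<in> \<T> \<and> set ws \<inter> \<B> = {})"
    (is "_ \<longleftrightarrow> ?walk v")
proof
  interpret pair_fin_digraph G by fact
  have "?walk v" if "v \<notin> Z_seq G \<T> \<B> k" "v \<in> pverts G" for k
    using that
  proof (induction k arbitrary: v)
    case 0
    then show ?case by (intro exI[of _ "[]"]) (auto simp: vwalk_def)
  next
    case (Suc k)
    show ?case
    proof (cases "v \<in> Z_seq G \<T> \<B> k")
      case False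
      then show ?thesis using Suc by blast
    next
      case True
      then obtain w where w: "(v, w) \<in> parcs G" "w \<notin> Z_seq G \<T> \<B> k" "w \<notin> \<B>"
        using Suc.prems by auto
      then obtain ws where "vwalk (w # ws) (with_proj G)" "last (w # ws) \<in> \<T>" "set ws \<inter> \<B> = {}"
        using Suc.IH[OF w(2)] in_arcsD2 by blast
      then show ?thesis using w Suc.prems(2)
        by (intro exI[of _ "w # ws"]) (auto intro: vwalk_consI)
    qed
  qed
  then show "?walk v" if "v \<notin> Z_lim G \<T> \<B>"
  proof -
    obtain k where "v \<notin> Z_seq G \<T> \<B> k" using \<open>v \<notin> Z_lim G \<T> \<B>\<close> by (auto simp: Z_lim_def)
    then show ?thesis using v by fact
  qed
next
  have "v \<notin> Z_lim G \<T> \<B>" if "vwalk (v # ws) (with_proj G)" "last (v # ws) \<in> \<T>" "set ws \<inter> \<B> = {}" for ws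
    using that
  proof (induction ws arbitrary: v)
    case Nil
    then show ?case using Z_lim_subset[of G \<T> \<B>] by auto
  next
    case (Cons w ws)
    then have "(v, w) \<in> parcs G" "w \<notin> Z_lim G \<T> \<B>" "w \<notin> \<B>"
      by (auto elim: vwalk_consE)
    then show ?case using Z_lim_step[OF G] by blast
  qed
  then show "v \<notin> Z_lim G \<T> \<B>" if "?walk v" using that by blast
qed

text \<open>
  Disjointness of \<open>\<D>\<close> and \<open>\<T>\<close> makes every path from \<open>\<D>\<close> to \<open>\<T>\<close> have an edge, so that
  none is exempt from the path condition.
\<close>

lemma S_lim_subset_Z_lim_iff:
  assumes G: "pair_fin_digraph G" and D: "\<D> \<subseteq> pverts G" and DT: "\<D> \<inter> \<T> = {}"
  shows "S_lim G \<D> \<C> \<subseteq> Z_lim G \<T> \<B> \<longleftrightarrow> output_before_input_on_paths G \<B> \<C> \<D> \<T>"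
proof -
  interpret pair_fin_digraph G by fact
  note S = S_lim_iff_vwalk[OF pair_wf_digraph_axioms D]
  have long: "length p \<ge> 2" if "path_from_to G \<D> \<T> p" for p
    using that DT by (cases p rule: remdups_adj.cases) (auto simp: path_from_to_def vwalk_def)
  have paths: "output_before_input_on_paths G \<B> \<C> \<D> \<T> \<longleftrightarrow>
      \<not> (\<exists>p. path_from_to G \<D> \<T> p \<and> unguarded \<B> \<C> p)"
  proof -
    have "(path_from_to G \<D> \<T> p \<and> vwalk_length p \<ge> 1 \<longrightarrow>
        output_positions \<C> p \<noteq> {} \<and> input_positions \<B> p \<noteq> {} \<and>
        Min (output_positions \<C> p) < Max (input_positions \<B> p)) \<longleftrightarrow>
      (path_from_to G \<D> \<T> p \<longrightarrow> \<not> unguarded \<B> \<C> p)" for p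
    proof (cases "path_from_to G \<D> \<T> p")
      case True
      then have "vwalk_length p \<ge> 1" using long[OF True] by simp
      then show ?thesis
        using True output_before_input_iff_not_unguarded[OF long[OF True]] by blast
    qed simp
    then show ?thesis unfolding output_before_input_on_paths_def by blast
  qed
  also have "\<dots> \<longleftrightarrow> \<not> (\<exists>v. v \<in> S_lim G \<D> \<C> \<and> v \<notin> Z_lim G \<T> \<B>)"
  proof -
    have walk_to_path: "\<exists>p. path_from_to G \<D> \<T> p \<and> unguarded \<B> \<C> p"
      if vS: "v \<in> S_lim G \<D> \<C>" and vZ: "v \<notin> Z_lim G \<T> \<B>" for v
    proof -
      obtain us where us: "vwalk (us @ [v]) (with_proj G)" "hd (us @ [v]) \<in> \<D>" "set us \<inter> \<C> = {}"
        using vS S by blast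
      then have "v \<in> pverts G" by (auto simp: vwalk_def)
      then obtain ws where ws: "vwalk (v # ws) (with_proj G)" "last (v # ws) \<in> \<T>" "set ws \<inter> \<B> = {}"
        using vZ not_in_Z_lim_iff_vwalk[OF G] by blast
      have "vwalk (us @ v # ws) (with_proj G)" using us(1) ws(1) by (simp add: vwalk_append_iff[of us v ws])
      moreover have "unguarded \<B> \<C> (us @ v # ws)" using us ws unfolding unguarded_def by blast
      ultimately obtain q where "vpath q (with_proj G)" "unguarded \<B> \<C> q"
        "hd q = hd (us @ v # ws)" "last q = last (us @ v # ws)"
        using unguarded_vwalk_imp_vpath by metis
      then show ?thesis using us(2) ws(2) unfolding path_from_to_def
        by (intro exI[of _ q]) (auto simp: hd_append)
    qed
    have path_to_node: "\<exists>v. v \<in> S_lim G \<D> \<C> \<and> v \<notin> Z_lim G \<T> \<B>"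
      if p: "path_from_to G \<D> \<T> p" and u: "unguarded \<B> \<C> p" for p
    proof -
      obtain us v ws where eq: "p = us @ v # ws" and d: "set us \<inter> \<C> = {}" "set ws \<inter> \<B> = {}"
        using u unfolding unguarded_def by blast
      have "vwalk (us @ [v]) (with_proj G)" "vwalk (v # ws) (with_proj G)"
        using p by (auto simp add: path_from_to_def vpath_def eq vwalk_append_iff[of us v ws])
      moreover have "hd (us @ [v]) \<in> \<D>" "last (v # ws) \<in> \<T>"
        using p by (auto simp: path_from_to_def eq hd_append)
      moreover have "v \<in> pverts G" using p by (auto simp: path_from_to_def vpath_def vwalk_def eq)
      ultimately show ?thesis using S not_in_Z_lim_iff_vwalk[OF G] d by blast
    qed
    show ?thesis
      by (intro arg_cong[of _ _ Not] iffI; elim exE conjE; rule walk_to_path path_to_node; assumption)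
  qed
  finally show ?thesis by blast
qed

section \<open>Resolvents and supports\<close>

text \<open>The Laplace variable \<open>s\<close>, as an element of the field of rational functions.\<close>

definition indet :: "real poly fract" where "indet = to_fract [:0, 1:]"

text \<open>The two nested conditionals let the simplifier collapse sums over \<open>i\<close> or \<open>j\<close>.\<close>

definition coord_proj :: "nat \<Rightarrow> nat set \<Rightarrow> real mat" where
  "coord_proj n X = mat n n (\<lambda>(i, j). if i = j then if j \<in> X then 1 else 0 else 0)"

definition row_supp :: "nat set \<Rightarrow> 'a::zero mat \<Rightarrow> bool" where
  "row_supp X Y \<longleftrightarrow> (\<forall>i<dim_row Y. \<forall>j<dim_col Y. i \<notin> X \<longrightarrow> Y $$ (i, j) = 0)"

lemma const_mat_carrier [simp]: "const_mat A \<in> carrier_mat (dim_row A) (dim_col A)"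
  "dim_row (const_mat A) = dim_row A" "dim_col (const_mat A) = dim_col A"
  by (auto simp: const_mat_def)

lemma const_mat_carrierI: "A \<in> carrier_mat n m \<Longrightarrow> const_mat A \<in> carrier_mat n m"
  by (auto simp: const_mat_def)

lemma index_const_mat [simp]:
  "i < dim_row A \<Longrightarrow> j < dim_col A \<Longrightarrow> const_mat A $$ (i, j) = to_fract [:A $$ (i, j):]"
  by (simp add: const_mat_def)

lemma index_const_mat_mult:
  assumes "A \<in> carrier_mat l n" "X \<in> carrier_mat n m" "i < l" "k < m"
  shows "(const_mat A * X) $$ (i, k) = (\<Sum>j<n. to_fract [:A $$ (i, j):] * X $$ (j, k))"
  using assms by (simp add: scalar_prod_def atLeast0LessThan)

lemma char_matrix_eq:
  assumes "A \<in> carrier_mat n n"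
  shows "map_mat to_fract (char_poly_matrix A) = indet \<cdot>\<^sub>m 1\<^sub>m n - const_mat A"
proof -
  have "to_fract [:- a, 1:] = indet - to_fract [:a:]"
       "to_fract [:- a:] = - to_fract [:a:]" for a :: real
    by (simp_all add: indet_def flip: to_fract_diff to_fract_uminus)
  then show ?thesis using assms by (intro eq_matI) (auto simp: char_poly_matrix_def one_pCons[symmetric])
qed

lemma char_matrix_mult:
  assumes A: "A \<in> carrier_mat n n" and X: "X \<in> carrier_mat n m"
  shows "map_mat to_fract (char_poly_matrix A) * X = indet \<cdot>\<^sub>m X - const_mat A * X"
proof -
  have "(indet \<cdot>\<^sub>m 1\<^sub>m n) * X = indet \<cdot>\<^sub>m X"
    using X by (subst mult_smult_assoc_mat[of _ n n _ m]) auto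
  then show ?thesis unfolding char_matrix_eq[OF A]
    using minus_mult_distrib_mat[of "indet \<cdot>\<^sub>m 1\<^sub>m n" n n "const_mat A" X m] A X
    by (simp add: const_mat_carrierI)
qed

text \<open>
  \<open>resolvent A * V\<close> is the Laplace transform of the response of \<open>dx/dt = A x + v\<close> from rest. The
  equation \<open>s X = V + A X\<close> is easier to verify and to decompose than a statement about an inverse.
\<close>

lemma laplace_equation_iff:
  assumes A: "A \<in> carrier_mat n n" and X: "X \<in> carrier_mat n m" and V: "V \<in> carrier_mat n m"
  shows "indet \<cdot>\<^sub>m X = V + const_mat A * X \<longleftrightarrow> X = resolvent A * V"
proof -
  let ?P = "map_mat to_fract (char_poly_matrix A) :: real poly fract mat"
  have P: "?P \<in> carrier_mat n n" using A by simp
  note R = resolvent_inverse[OF A]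
  have "indet \<cdot>\<^sub>m X = V + const_mat A * X \<longleftrightarrow> indet \<cdot>\<^sub>m X - const_mat A * X = V"
  proof
    assume "indet \<cdot>\<^sub>m X = V + const_mat A * X"
    then show "indet \<cdot>\<^sub>m X - const_mat A * X = V" using V A X by (intro eq_matI) auto
  next
    assume *: "indet \<cdot>\<^sub>m X - const_mat A * X = V"
    show "indet \<cdot>\<^sub>m X = V + const_mat A * X"
      unfolding *[symmetric] using A X by (intro eq_matI) auto
  qed
  also have "\<dots> \<longleftrightarrow> ?P * X = V" using char_matrix_mult[OF A X] by simp
  also have "\<dots> \<longleftrightarrow> X = resolvent A * V"
  proof
    assume "?P * X = V"
    then have "resolvent A * V = (resolvent A * ?P) * X"
      using assoc_mult_mat[OF R(1) P X] by simp
    then show "X = resolvent A * V" using R X by simp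
  next
    assume "X = resolvent A * V"
    then have "?P * X = (?P * resolvent A) * V"
      using assoc_mult_mat[OF P R(1) V] by simp
    then show "?P * X = V" using R V by simp
  qed
  finally show ?thesis .
qed

text \<open>
  If no edge leads out of the node set \<open>X\<close>, an input acting on \<open>X\<close> never excites the other nodes.
  Indeed, the part of the response outside \<open>X\<close> solves the homogeneous equation of the subsystem
  outside \<open>X\<close>, which has only the solution zero because a resolvent is invertible.
\<close>

lemma row_supp_resolvent:
  assumes A: "A \<in> carrier_mat n n" and V: "V \<in> carrier_mat n m"
    and inv: "\<And>i j. i < n \<Longrightarrow> j < n \<Longrightarrow> i \<notin> X \<Longrightarrow> j \<in> X \<Longrightarrow> A $$ (i, j) = 0"
    and supp: "row_supp X V"
  shows "row_supp X (resolvent A * V)"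
proof -
  let ?Y = "resolvent A * V"
  \<comment> \<open>the subsystem outside \<open>X\<close>, padded with zeros so that all dimensions stay \<open>n\<close>\<close>
  define A' where "A' = mat n n (\<lambda>(i, j). if i \<in> X \<or> j \<in> X then 0 else A $$ (i, j))"
  define Y' where "Y' = mat n m (\<lambda>(i, k). if i \<in> X then 0 else ?Y $$ (i, k))"
  have Y: "?Y \<in> carrier_mat n m" using resolvent_inverse(1)[OF A] V by simp
  have A': "A' \<in> carrier_mat n n" and Y': "Y' \<in> carrier_mat n m" by (auto simp: A'_def Y'_def)
  have eq: "indet \<cdot>\<^sub>m ?Y = V + const_mat A * ?Y" using laplace_equation_iff[OF A Y V] by simp
  have "indet \<cdot>\<^sub>m Y' = 0\<^sub>m n m + const_mat A' * Y'"
  proof (rule eq_matI)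
    fix i k assume ik: "i < dim_row (0\<^sub>m n m + const_mat A' * Y')" "k < dim_col (0\<^sub>m n m + const_mat A' * Y')"
    then have i: "i < n" and k: "k < m" using A' Y' by auto
    have mult: "(const_mat A' * Y') $$ (i, k) = (\<Sum>j<n. to_fract [:A' $$ (i, j):] * Y' $$ (j, k))"
      by (rule index_const_mat_mult[OF A' Y' i k])
    show "(indet \<cdot>\<^sub>m Y') $$ (i, k) = (0\<^sub>m n m + const_mat A' * Y') $$ (i, k)"
    proof (cases "i \<in> X")
      case True
      have "(const_mat A' * Y') $$ (i, k) = 0" unfolding mult
        using True i by (intro sum.neutral) (auto simp: A'_def)
      then show ?thesis using True i k A' Y' by (auto simp: Y'_def)
    next
      case False
      have "indet * ?Y $$ (i, k) = (indet \<cdot>\<^sub>m ?Y) $$ (i, k)"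
        using Y i k by (subst index_smult_mat) auto
      also have "\<dots> = V $$ (i, k) + (const_mat A * ?Y) $$ (i, k)"
        unfolding eq using V A Y i k by (simp add: const_mat_carrierI)
      also have "V $$ (i, k) = 0" using supp V False i k by (auto simp: row_supp_def)
      also have "(const_mat A * ?Y) $$ (i, k) = (\<Sum>j<n. to_fract [:A $$ (i, j):] * ?Y $$ (j, k))"
        by (rule index_const_mat_mult[OF A Y i k])
      also have "\<dots> = (const_mat A' * Y') $$ (i, k)" unfolding mult
        using i k False inv[of i] by (intro sum.cong) (auto simp: A'_def Y'_def)
      finally show ?thesis using False i k A' Y' by (simp add: Y'_def)
    qed
  qed (use A' Y' in auto)
  then have "Y' = resolvent A' * 0\<^sub>m n m"
    using laplace_equation_iff[OF A' Y'] by simp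
  then have "Y' = 0\<^sub>m n m" using resolvent_inverse(1)[OF A'] by simp
  have "?Y $$ (i, k) = 0" if "i < n" "k < m" "i \<notin> X" for i k
  proof -
    have "?Y $$ (i, k) = Y' $$ (i, k)" using that by (simp add: Y'_def)
    also have "\<dots> = 0" unfolding \<open>Y' = 0\<^sub>m n m\<close> using that by simp
    finally show ?thesis .
  qed
  then show ?thesis using Y unfolding row_supp_def by (metis carrier_matD)
qed

section \<open>Input, output and target matrices of node sets\<close>

lemma node_cols_carrier [simp]: "finite X \<Longrightarrow> node_cols n X \<in> carrier_mat n (card X)"
  by (auto simp: node_cols_def)

lemma node_rows_carrier [simp]: "finite X \<Longrightarrow> node_rows n X \<in> carrier_mat (card X) n"
  by (auto simp: node_rows_def)

lemma node_cols_mult_node_rows: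
  assumes "X \<subseteq> {0..<n}"
  shows "node_cols n X * node_rows n X = coord_proj n X"
proof (rule eq_matI)
  let ?l = "sorted_list_of_set X"
  have fin: "finite X" using assms finite_subset by blast
  have l: "?l ! k < n" if "k < card X" for k
    using that assms fin by (metis atLeastLessThan_iff nth_mem set_sorted_list_of_set length_sorted_list_of_set subset_iff)
  fix i j assume "i < dim_row (coord_proj n X)" "j < dim_col (coord_proj n X)"
  then have ij: "i < n" "j < n" by (auto simp: coord_proj_def)
  have "(node_cols n X * node_rows n X) $$ (i, j) =
      (\<Sum>k<card X. (if i = ?l ! k then 1 else 0) * (if j = ?l ! k then 1 else 0))"
    using ij l by (auto simp: node_cols_def node_rows_def scalar_prod_def mat_of_cols_index mat_of_rows_index
        atLeast0LessThan intro!: sum.cong)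
  also have "\<dots> = (\<Sum>x\<in>X. (if i = x then 1 else 0) * (if j = x then 1 else 0))"
    using sum.reindex_bij_betw[OF bij_betw_nth[of ?l "{..<card X}" X]] fin by simp
  also have "\<dots> = (if i = j \<and> i \<in> X then 1 else 0)"
    using fin by (auto simp: if_distrib[of "\<lambda>a. a * _"] cong: if_cong)
  finally show "(node_cols n X * node_rows n X) $$ (i, j) = coord_proj n X $$ (i, j)"
    using ij by (simp add: coord_proj_def)
qed (auto simp: node_cols_def node_rows_def coord_proj_def)

lemma row_supp_node_cols:
  assumes "X \<subseteq> {0..<n}"
  shows "row_supp X (const_mat (node_cols n X))"
proof -
  have fin: "finite X" using assms finite_subset by blast
  have "sorted_list_of_set X ! k \<in> X" if "k < card X" for k
    using that fin by (metis nth_mem set_sorted_list_of_set length_sorted_list_of_set)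
  then show ?thesis using assms
    by (fastforce simp: row_supp_def node_cols_def mat_of_cols_index unit_vec_def)
qed

lemma node_rows_mult_eq_zero:
  assumes X: "X \<subseteq> {0..<n}" and Y: "Y \<in> carrier_mat n m" and supp: "row_supp Z Y" and disj: "Z \<inter> X = {}"
  shows "const_mat (node_rows n X) * Y = 0\<^sub>m (card X) m"
proof (rule eq_matI)
  let ?l = "sorted_list_of_set X"
  have fin: "finite X" using X finite_subset by blast
  fix i j assume "i < dim_row (0\<^sub>m (card X) m)" "j < dim_col (0\<^sub>m (card X) m)"
  then have ij: "i < card X" "j < m" by auto
  have lX: "?l ! i \<in> X" using ij fin by (metis nth_mem set_sorted_list_of_set length_sorted_list_of_set)
  have "to_fract [:unit_vec n (?l ! i) $ k:] * Y $$ (k, j) = 0" if "k < n" for k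
  proof (cases "k = ?l ! i")
    case True
    then show ?thesis using that lX supp disj Y ij by (auto simp: row_supp_def)
  next
    case False
    then show ?thesis using that by (simp add: unit_vec_def)
  qed
  then show "(const_mat (node_rows n X) * Y) $$ (i, j) = 0\<^sub>m (card X) m $$ (i, j)"
    using ij Y fin
    by (auto simp: scalar_prod_def const_mat_def node_rows_def mat_of_rows_index intro!: sum.neutral)
qed (use assms in \<open>auto simp: node_rows_def\<close>)


section \<open>The decoupling compensator\<close>

definition restrict_entries :: "nat set \<Rightarrow> nat set \<Rightarrow> real mat \<Rightarrow> real mat" where
  "restrict_entries X Y A = mat (dim_row A) (dim_col A) (\<lambda>(i, j). if i \<in> X \<and> j \<in> Y then A $$ (i, j) else 0)"

lemma restrict_entries_carrier: "A \<in> carrier_mat n m \<Longrightarrow> restrict_entries X Y A \<in> carrier_mat n m"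
  by (auto simp: restrict_entries_def)

lemma index_restrict_entries: "A \<in> carrier_mat n m \<Longrightarrow> i < n \<Longrightarrow> j < m \<Longrightarrow>
    restrict_entries X Y A $$ (i, j) = (if i \<in> X \<and> j \<in> Y then A $$ (i, j) else 0)"
  by (auto simp: restrict_entries_def)

lemma restrict_entries_restrict_entries [simp]: "restrict_entries X Y (restrict_entries X' Y' A) = restrict_entries (X \<inter> X') (Y \<inter> Y') A"
  by (auto simp: restrict_entries_def intro!: eq_matI)

lemma coord_proj_mult:
  assumes "A \<in> carrier_mat n m"
  shows "coord_proj n X * A = restrict_entries X UNIV A"
  using assms
  by (intro eq_matI) (auto simp: coord_proj_def restrict_entries_def scalar_prod_def if_distrib[of "\<lambda>a. a * _"] cong: if_cong)

lemma mult_coord_proj: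
  assumes "A \<in> carrier_mat m n"
  shows "A * coord_proj n X = restrict_entries UNIV X A"
  using assms
  by (intro eq_matI) (auto simp: coord_proj_def restrict_entries_def scalar_prod_def if_distrib[of "\<lambda>a. _ * a"]
      if_if_eq_conj[symmetric] cong: if_cong conj_cong)

text \<open>
  Since inputs and outputs are single nodes, feedback can cancel or reproduce every
  edge weight into an input node (first equation), out of an output node (second), or from an
  output node to an input node (third) independently of the others.
\<close>

lemma node_gain_realizes_restrict_entries:
  assumes A: "A \<in> carrier_mat n n" and X: "X \<subseteq> {0..<n}" and Y: "Y \<subseteq> {0..<n}"
  shows "node_cols n X * (node_rows n X * A) = restrict_entries X UNIV A"
    and "(A * node_cols n Y) * node_rows n Y = restrict_entries UNIV Y A"
    and "node_cols n X * (node_rows n X * A * node_cols n Y) * node_rows n Y = restrict_entries X Y A"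
proof -
  have fin: "finite X" "finite Y" using X Y finite_subset by blast+
  note c = node_cols_carrier[OF fin(1)] node_rows_carrier[OF fin(1)]
    node_cols_carrier[OF fin(2)] node_rows_carrier[OF fin(2)]
  show left: "node_cols n X * (node_rows n X * A) = restrict_entries X UNIV A"
    unfolding coord_proj_mult[OF A, symmetric] node_cols_mult_node_rows[OF X, symmetric]
    by (rule assoc_mult_mat[OF c(1,2) A, symmetric])
  \<comment> \<open>for arbitrary \<open>M\<close>, as the third equation applies it to a matrix already restricted to rows \<open>X\<close>\<close>
  have right: "(M * node_cols n Y) * node_rows n Y = restrict_entries UNIV Y M" if M: "M \<in> carrier_mat n n" for M
    unfolding mult_coord_proj[OF M, symmetric] node_cols_mult_node_rows[OF Y, symmetric]
    by (rule assoc_mult_mat[OF M c(3,4)])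
  then show "(A * node_cols n Y) * node_rows n Y = restrict_entries UNIV Y A" using A .
  have "node_cols n X * (node_rows n X * A * node_cols n Y) = restrict_entries X UNIV A * node_cols n Y"
    unfolding left[symmetric]
    by (rule assoc_mult_mat[OF c(1) mult_carrier_mat[OF c(2) A] c(3), symmetric])
  then show "node_cols n X * (node_rows n X * A * node_cols n Y) * node_rows n Y = restrict_entries X Y A"
    using right[OF restrict_entries_carrier[OF A]] by simp
qed

lemma four_block_mult_append_rows:
  assumes "A \<in> carrier_mat r n" "B \<in> carrier_mat r m" "C \<in> carrier_mat q n" "D \<in> carrier_mat q m"
    "X \<in> carrier_mat n c" "Y \<in> carrier_mat m c"
  shows "four_block_mat A B C D * (X @\<^sub>r Y) = (A * X + B * Y) @\<^sub>r (C * X + D * Y)"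
proof -
  have "X @\<^sub>r Y = four_block_mat X (0\<^sub>m n 0) Y (0\<^sub>m m 0)" using assms by (auto simp: append_rows_def)
  then show ?thesis
    using mult_four_block_mat[OF assms(1-5) zero_carrier_mat assms(6) zero_carrier_mat] assms
    by (auto simp: append_rows_def intro!: cong_four_block_mat eq_matI)
qed

lemma row_supp_mono: "row_supp X Y \<Longrightarrow> X \<subseteq> X' \<Longrightarrow> row_supp X' Y"
  by (auto simp: row_supp_def)

lemma row_supp_add:
  fixes Y Y' :: "'a::monoid_add mat"
  shows "Y \<in> carrier_mat n m \<Longrightarrow> Y' \<in> carrier_mat n m \<Longrightarrow> row_supp X Y \<Longrightarrow> row_supp X Y' \<Longrightarrow> row_supp X (Y + Y')"
  by (auto simp: row_supp_def)

lemma row_supp_mult: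
  assumes A: "A \<in> carrier_mat l n" and Y: "Y \<in> carrier_mat n m" and supp: "row_supp X Y"
    and maps: "\<And>i j. i < l \<Longrightarrow> j < n \<Longrightarrow> i \<notin> X' \<Longrightarrow> j \<in> X \<Longrightarrow> A $$ (i, j) = 0"
  shows "row_supp X' (const_mat A * Y)"
proof -
  have "(const_mat A * Y) $$ (i, k) = 0" if "i < l" "k < m" "i \<notin> X'" for i k
    unfolding index_const_mat_mult[OF A Y that(1,2)] using that maps supp Y
    by (intro sum.neutral) (auto simp: row_supp_def)
  then show ?thesis using A Y by (auto simp: row_supp_def)
qed

text \<open>
  \<open>S\<close> need only be invariant under \<open>A\<close> as long as the state is unmeasured, and \<open>Z\<close> only up to what the
  inputs can cancel: coordinate versions of conditioned and controlled invariance.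
  In the variables \<open>e = x - x'\<close> and \<open>x'\<close> of the introduction, the invariant subspace of the closed
  loop is the coordinate subspace \<open>S \<times> Z\<close>. In the proof, \<open>e\<close> and \<open>x\<close> denote the transforms of
  the observation error and of the compensator state, one column per disturbance, so that
  the plant state is \<open>e + x\<close>.
\<close>

lemma DDPDF_solvable_if_nested_invariants:
  assumes A: "A \<in> carrier_mat n n"
    and B: "\<B> \<subseteq> {0..<n}" and C: "\<C> \<subseteq> {0..<n}" and D: "\<D> \<subseteq> {0..<n}" and T: "\<T> \<subseteq> {0..<n}"
    and nested: "\<D> \<subseteq> S" "S \<subseteq> Z" "Z \<inter> \<T> = {}"
    and S: "\<And>i j. i < n \<Longrightarrow> j < n \<Longrightarrow> A $$ (i, j) \<noteq> 0 \<Longrightarrow> j \<in> S \<Longrightarrow> j \<notin> \<C> \<Longrightarrow> i \<in> S"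
    and Z: "\<And>i j. i < n \<Longrightarrow> j < n \<Longrightarrow> A $$ (i, j) \<noteq> 0 \<Longrightarrow> j \<in> Z \<Longrightarrow> i \<in> Z \<union> \<B>"
  shows "DDPDF_solvable A (node_cols n \<B>) (node_rows n \<C>) (node_cols n \<D>) (node_rows n \<T>)"
proof -
  let ?B = "node_cols n \<B>" and ?C = "node_rows n \<C>" and ?D = "node_cols n \<D>" and ?T = "node_rows n \<T>"
  have fin: "finite \<B>" "finite \<C>" "finite \<D>" "finite \<T>" using B C D T finite_subset by blast+
  have c: "?B \<in> carrier_mat n (card \<B>)" "?C \<in> carrier_mat (card \<C>) n"
    "?D \<in> carrier_mat n (card \<D>)" "?T \<in> carrier_mat (card \<T>) n" using fin by auto
  note mc = restrict_entries_carrier[OF A] and cm = const_mat_carrierI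

  define K where "K = restrict_entries (- \<B>) (- \<C>) A"
  define L where "L = restrict_entries (- \<B>) UNIV A * node_cols n \<C>"
  define M where "M = node_rows n \<B> * restrict_entries UNIV (- \<C>) A"
  define F where "F = node_rows n \<B> * A * node_cols n \<C>"
  have carrier: "K \<in> carrier_mat n n" "L \<in> carrier_mat n (card \<C>)"
    "M \<in> carrier_mat (card \<B>) n" "F \<in> carrier_mat (card \<B>) (card \<C>)"
    unfolding K_def L_def M_def F_def
    by (rule mc mult_carrier_mat[OF mc] mult_carrier_mat[OF _ mc] mult_carrier_mat[OF mult_carrier_mat[OF _ A]]
        node_cols_carrier node_rows_carrier fin)+
  \<comment> \<open>\<open>F\<close> is the static output gain, called \<open>G\<close> in \<open>DDPDF_solvable\<close>\<close>
  have BFC: "?B * F * ?C = restrict_entries \<B> \<C> A" and BM: "?B * M = restrict_entries \<B> (- \<C>) A"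
    and LC: "L * ?C = restrict_entries (- \<B>) \<C> A"
    unfolding F_def M_def L_def
    using node_gain_realizes_restrict_entries[OF A B C] node_gain_realizes_restrict_entries(1)[OF mc B C]
      node_gain_realizes_restrict_entries(2)[OF mc B C] by simp_all

  define A11 A12 A21 where "A11 = A - restrict_entries \<B> \<C> A" and "A12 = - restrict_entries \<B> (- \<C>) A"
    and "A21 = restrict_entries (- \<B>) \<C> A"
  have Aij: "A11 \<in> carrier_mat n n" "A12 \<in> carrier_mat n n" "A21 \<in> carrier_mat n n"
    unfolding A11_def A12_def A21_def by (rule minus_carrier_mat[OF mc] uminus_carrier_mat[OF mc] mc)+
  define Ac where "Ac = four_block_mat A11 A12 A21 K"
  define Dc where "Dc = ?D @\<^sub>r 0\<^sub>m n (card \<D>)"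
  define Tc where "Tc = four_block_mat ?T (0\<^sub>m (card \<T>) n) (0\<^sub>m 0 n) (0\<^sub>m 0 n)"
  have Ac: "Ac \<in> carrier_mat (n + n) (n + n)" and Dc: "Dc \<in> carrier_mat (n + n) (card \<D>)"
    and Tc: "Tc \<in> carrier_mat (card \<T>) (n + n)"
    using Aij carrier c four_block_carrier_mat[OF c(4), of "0\<^sub>m 0 n" 0 n] by (auto simp: Ac_def Dc_def Tc_def)

  \<comment> \<open>the cascade: the error is driven by the disturbance, the compensator by the error\<close>
  define e where "e = resolvent (restrict_entries UNIV (- \<C>) A) * const_mat ?D"
  define x where "x = resolvent (restrict_entries (- \<B>) UNIV A) * (const_mat A21 * e)"
  have e: "e \<in> carrier_mat n (card \<D>)" unfolding e_def
    by (rule mult_carrier_mat[OF resolvent_inverse(1)[OF mc] cm[OF c(3)]])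
  have Ve: "const_mat A21 * e \<in> carrier_mat n (card \<D>)" by (rule mult_carrier_mat[OF cm[OF Aij(3)] e])
  have x: "x \<in> carrier_mat n (card \<D>)" unfolding x_def
    by (rule mult_carrier_mat[OF resolvent_inverse(1)[OF mc] Ve])

  have supp_e: "row_supp S e" unfolding e_def
    by (rule row_supp_resolvent[OF mc cm[OF c(3)] _ row_supp_mono[OF row_supp_node_cols[OF D] nested(1)]])
      (use S in \<open>auto simp: index_restrict_entries[OF A]\<close>)
  have "row_supp Z (const_mat A21 * e)"
    by (rule row_supp_mult[OF Aij(3) e supp_e]) (use Z nested(2) in \<open>auto simp: A21_def index_restrict_entries[OF A]\<close>)
  then have supp_x: "row_supp Z x" unfolding x_def
    by (rule row_supp_resolvent[OF mc Ve, rotated]) (use Z in \<open>auto simp: index_restrict_entries[OF A]\<close>)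

  have eq_e: "indet \<cdot>\<^sub>m e = const_mat ?D + const_mat (restrict_entries UNIV (- \<C>) A) * e"
    using laplace_equation_iff[OF mc e cm[OF c(3)]] by (simp add: e_def)
  have eq_x: "indet \<cdot>\<^sub>m x = const_mat A21 * e + const_mat (restrict_entries (- \<B>) UNIV A) * x"
    using laplace_equation_iff[OF mc x Ve] by (simp add: x_def)
  have entry_e: "indet * e $$ (i, k) = to_fract [:?D $$ (i, k):] +
      (\<Sum>j<n. to_fract [:restrict_entries UNIV (- \<C>) A $$ (i, j):] * e $$ (j, k))"
    if "i < n" "k < card \<D>" for i k
    using arg_cong[OF eq_e, of "\<lambda>N. N $$ (i, k)"] that e c(3) mc[of UNIV "- \<C>"]
    by (simp add: index_const_mat_mult[OF mc e] del: index_mult_mat(1))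
  have entry_x: "indet * x $$ (i, k) = (\<Sum>j<n. to_fract [:A21 $$ (i, j):] * e $$ (j, k)) +
      (\<Sum>j<n. to_fract [:restrict_entries (- \<B>) UNIV A $$ (i, j):] * x $$ (j, k))"
    if "i < n" "k < card \<D>" for i k
    using arg_cong[OF eq_x, of "\<lambda>N. N $$ (i, k)"] that e x Aij(3) mc[of "- \<B>" UNIV]
    by (simp add: index_const_mat_mult[OF mc x] index_const_mat_mult[OF Aij(3) e] del: index_mult_mat(1))
  \<comment> \<open>back in the original coordinates, \<open>(e + x, x)\<close> solves the closed-loop equations\<close>
  note entries = A11_def A12_def A21_def K_def index_restrict_entries[OF A]
  have plant: "indet \<cdot>\<^sub>m (e + x) = const_mat ?D + (const_mat A11 * (e + x) + const_mat A12 * x)"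
  proof (rule eq_matI)
    fix i k assume "i < dim_row (const_mat ?D + (const_mat A11 * (e + x) + const_mat A12 * x))"
      "k < dim_col (const_mat ?D + (const_mat A11 * (e + x) + const_mat A12 * x))"
    then have ik: "i < n" "k < card \<D>" using Aij e x by auto
    have "(\<Sum>j<n. to_fract [:restrict_entries UNIV (- \<C>) A $$ (i, j):] * e $$ (j, k)) +
        (\<Sum>j<n. to_fract [:A21 $$ (i, j):] * e $$ (j, k)) +
        (\<Sum>j<n. to_fract [:restrict_entries (- \<B>) UNIV A $$ (i, j):] * x $$ (j, k)) =
      (\<Sum>j<n. to_fract [:A11 $$ (i, j):] * (e + x) $$ (j, k)) +
        (\<Sum>j<n. to_fract [:A12 $$ (i, j):] * x $$ (j, k))"
      unfolding sum.distrib[symmetric]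
    proof (rule sum.cong[OF refl])
      fix j assume "j \<in> {..<n}"
      then have j: "j < n" by simp
      have neg: "to_fract [:- a:] = - to_fract [:a:]" for a :: real by (simp flip: to_fract_uminus)
      show "to_fract [:restrict_entries UNIV (- \<C>) A $$ (i, j):] * e $$ (j, k) + to_fract [:A21 $$ (i, j):] * e $$ (j, k) +
          to_fract [:restrict_entries (- \<B>) UNIV A $$ (i, j):] * x $$ (j, k) =
        to_fract [:A11 $$ (i, j):] * (e + x) $$ (j, k) + to_fract [:A12 $$ (i, j):] * x $$ (j, k)"
        using ik j A e x mc[of \<B> \<C>] mc[of \<B> "- \<C>"]
        by (cases "i \<in> \<B>"; cases "j \<in> \<C>") (simp_all add: entries neg algebra_simps)
    qed
    then show "(indet \<cdot>\<^sub>m (e + x)) $$ (i, k) =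
        (const_mat ?D + (const_mat A11 * (e + x) + const_mat A12 * x)) $$ (i, k)"
      using ik e x c(3) Aij entry_e[OF ik] entry_x[OF ik]
      by (simp add: index_const_mat_mult[OF Aij(1) add_carrier_mat[OF x]] index_const_mat_mult[OF Aij(2) x]
          distrib_left add.assoc del: index_mult_mat(1))
  qed (use c Aij e x in auto)
  have compensator: "indet \<cdot>\<^sub>m x = const_mat A21 * (e + x) + const_mat K * x"
  proof (rule eq_matI)
    fix i k assume "i < dim_row (const_mat A21 * (e + x) + const_mat K * x)"
      "k < dim_col (const_mat A21 * (e + x) + const_mat K * x)"
    then have ik: "i < n" "k < card \<D>" using carrier x by auto
    have "(\<Sum>j<n. to_fract [:A21 $$ (i, j):] * e $$ (j, k)) +
        (\<Sum>j<n. to_fract [:restrict_entries (- \<B>) UNIV A $$ (i, j):] * x $$ (j, k)) =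
      (\<Sum>j<n. to_fract [:A21 $$ (i, j):] * (e + x) $$ (j, k)) +
        (\<Sum>j<n. to_fract [:K $$ (i, j):] * x $$ (j, k))"
      unfolding sum.distrib[symmetric]
      by (rule sum.cong[OF refl]) (use ik e x in \<open>auto simp: entries algebra_simps\<close>)
    then show "(indet \<cdot>\<^sub>m x) $$ (i, k) = (const_mat A21 * (e + x) + const_mat K * x) $$ (i, k)"
      using ik e x carrier Aij entry_x[OF ik]
      by (simp add: index_const_mat_mult[OF Aij(3) add_carrier_mat[OF x]] index_const_mat_mult[OF carrier(1) x]
          del: index_mult_mat(1))
  qed (use carrier Aij e x in auto)

  \<comment> \<open>uniqueness identifies this solution with the closed-loop response\<close>
  let ?X = "(e + x) @\<^sub>r x"
  have ex: "e + x \<in> carrier_mat n (card \<D>)" using e x by simp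
  have X: "?X \<in> carrier_mat (n + n) (card \<D>)" using ex x by simp
  have "const_mat Ac * ?X = (const_mat A11 * (e + x) + const_mat A12 * x) @\<^sub>r
      (const_mat A21 * (e + x) + const_mat K * x)"
    unfolding Ac_def const_mat_def map_four_block_mat[OF Aij carrier(1)]
    by (rule four_block_mult_append_rows) (use Aij carrier ex x in auto)
  moreover have "const_mat Dc = const_mat ?D @\<^sub>r 0\<^sub>m n (card \<D>)"
    using c(3) by (auto simp: Dc_def append_rows_def const_mat_def intro!: eq_matI)
  moreover have "indet \<cdot>\<^sub>m ?X = (indet \<cdot>\<^sub>m (e + x)) @\<^sub>r (indet \<cdot>\<^sub>m x)"
    using ex x by (auto simp: append_rows_def intro!: eq_matI)
  ultimately have "indet \<cdot>\<^sub>m ?X = const_mat Dc + const_mat Ac * ?X"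
    unfolding plant compensator using c(3) Aij carrier e x by (auto simp: append_rows_def intro!: eq_matI)
  then have X_eq: "?X = resolvent Ac * const_mat Dc"
    using laplace_equation_iff[OF Ac X cm[OF Dc]] by simp

  have "transfer_matrix Tc Ac Dc = const_mat Tc * ?X"
    unfolding transfer_matrix_def X_eq by (rule assoc_mult_mat[OF cm[OF Tc] resolvent_inverse(1)[OF Ac] cm[OF Dc]])
  also have "\<dots> = (const_mat ?T * (e + x) + 0\<^sub>m (card \<T>) n * x) @\<^sub>r (0\<^sub>m 0 n * (e + x) + 0\<^sub>m 0 n * x)"
  proof -
    have "const_mat Tc = four_block_mat (const_mat ?T) (0\<^sub>m (card \<T>) n) (0\<^sub>m 0 n) (0\<^sub>m 0 n)"
      using c(4) by (auto simp: Tc_def const_mat_def intro!: eq_matI)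
    then show ?thesis
      using four_block_mult_append_rows[OF cm[OF c(4)] zero_carrier_mat zero_carrier_mat zero_carrier_mat ex x]
      by simp
  qed
  also have "const_mat ?T * (e + x) = 0\<^sub>m (card \<T>) (card \<D>)"
    using nested supp_e supp_x
    by (intro node_rows_mult_eq_zero[OF T ex, of Z] row_supp_add[OF e x] row_supp_mono[OF supp_e])
  finally have "transfer_matrix Tc Ac Dc = 0\<^sub>m (card \<T>) (card \<D>)"
    using e x by (auto simp: append_rows_def)
  then show ?thesis
    unfolding DDPDF_solvable_def using A carrier c BFC BM LC
    by (intro exI[of _ n] exI[of _ K] exI[of _ L] exI[of _ M] exI[of _ F] conjI)
      (simp_all add: Let_def Ac_def Dc_def Tc_def A11_def A12_def A21_def)
qed

theorem theorem4:
  fixes n :: nat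
    and G :: "nat pair_pre_digraph"
    and A :: "real mat"
    and \<B> \<C> \<D> \<T> :: "nat set"
  assumes "weighted_digraph n G A"
    and "\<B> \<subseteq> pverts G" and "\<C> \<subseteq> pverts G"
    and "\<D> \<subseteq> pverts G" and "\<T> \<subseteq> pverts G"
    and "\<D> \<inter> \<T> = {}" and "\<D> \<inter> \<B> = {}" and "\<T> \<inter> \<C> = {}"
  shows "(S_lim G \<D> \<C> \<subseteq> Z_lim G \<T> \<B> \<longleftrightarrow> output_before_input_on_paths G \<B> \<C> \<D> \<T>) \<and>
    (S_lim G \<D> \<C> \<subseteq> Z_lim G \<T> \<B> \<or> output_before_input_on_paths G \<B> \<C> \<D> \<T> \<longrightarrow>
       DDPDF_solvable A (node_cols n \<B>) (node_rows n \<C>) (node_cols n \<D>) (node_rows n \<T>))"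
proof -
  have G: "pair_fin_digraph G" and verts: "pverts G = {0..<n}" and A: "A \<in> carrier_mat n n"
    and edges: "\<And>i j. i < n \<Longrightarrow> j < n \<Longrightarrow> A $$ (j, i) \<noteq> 0 \<longleftrightarrow> (i, j) \<in> parcs G"
    using assms(1) by (auto simp: weighted_digraph_def)
  have iff: "S_lim G \<D> \<C> \<subseteq> Z_lim G \<T> \<B> \<longleftrightarrow> output_before_input_on_paths G \<B> \<C> \<D> \<T>"
    using G assms(4,6) by (rule S_lim_subset_Z_lim_iff)
  have "DDPDF_solvable A (node_cols n \<B>) (node_rows n \<C>) (node_cols n \<D>) (node_rows n \<T>)"
    if sub: "S_lim G \<D> \<C> \<subseteq> Z_lim G \<T> \<B>"
  proof (rule DDPDF_solvable_if_nested_invariants[OF A _ _ _ _ _ sub])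
    show "\<D> \<subseteq> S_lim G \<D> \<C>" unfolding S_lim_def by (metis S_seq.simps(1) UN_upper UNIV_I)
    show "Z_lim G \<T> \<B> \<inter> \<T> = {}" using Z_lim_subset[of G \<T> \<B>] by blast
    show "i \<in> S_lim G \<D> \<C>" if "i < n" "j < n" "A $$ (i, j) \<noteq> 0" "j \<in> S_lim G \<D> \<C>" "j \<notin> \<C>" for i j
      using that edges S_lim_step by metis
    show "i \<in> Z_lim G \<T> \<B> \<union> \<B>" if "i < n" "j < n" "A $$ (i, j) \<noteq> 0" "j \<in> Z_lim G \<T> \<B>" for i j
      using that edges Z_lim_step[OF G] by metis
  qed (use assms verts in auto)
  then show ?thesis using iff by blast
qed

end
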